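(* Let $(X,T)$ be a minimal topological dynamical system and let $\pi: X\to X_D$ be the factor map onto its maximal distal factor. Then the following conditions are equivalent: (1) $(X,T)$ is strongly $\mathcal{F}_{ip}$-sensitive; (2) there is $\delta>0$ such that for every non-empty open subset $U$ of $X$ there exists a proximal pair $(x,y)$ with $x\in U$ and $d(x,y)>\delta$; (3) $\pi$ is not almost one-to-one.
   Context: A topological dynamical system $(X,T)$: compact metric space $(X,d)$, $T$ continuous surjective; minimal means every orbit is dense. A pair $(x,y)$ is proximal if $\inf_n d(T^nx,T^ny)=0$, otherwise distal; a system is distal if all pairs of distinct points are distal. The maximal distal factor $X_D$ is the distal factor of which every distal factor of $(X,T)$ is a factor (equivalently the quotient by the smallest closed invariant equivalence relation containing the proximal relation). An IP-set is a set containing $FS((p_i)_{i=1}^\infty)=\{\sum_{i\in\alpha}p_i:\alpha\subset\mathbb{N}$ finite nonempty$\}$ for some $p_i\in\mathbb{N}$; $\mathcal{F}_{ip}$ is the family of subsets of $\mathbb{Z}_+$ containing an IP-set. For a family $\mathcal{F}$, $(X,T)$ is strongly $\mathcal{F}$-sensitive if there is $\delta>0$ such that for each nonempty open $U$ there are $x,y\in U$ with $\{n\in\mathbb{Z}_+: d(T^nx,T^ny)>\delta\}\in\mathcal{F}$. A factor map $\pi$ is almost one-to-one if $\{x:\pi^{-1}(\pi(x))=\{x\}\}$ is dense. *)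

theory Defs
  imports "HOL-Analysis.Analysis"
begin

definition tds :: "('a::metric_space \<Rightarrow> 'a) \<Rightarrow> bool" where
  "tds T \<longleftrightarrow> compact (UNIV :: 'a set) \<and> continuous_on UNIV T \<and> surj T"

definition minimal_sys :: "('a::metric_space \<Rightarrow> 'a) \<Rightarrow> bool" where
  "minimal_sys T \<longleftrightarrow> (\<forall>x. closure (range (\<lambda>n. (T ^^ n) x)) = UNIV)"

definition proximal :: "('a::metric_space \<Rightarrow> 'a) \<Rightarrow> 'a \<Rightarrow> 'a \<Rightarrow> bool" where
  "proximal T x y \<longleftrightarrow> (INF n. dist ((T ^^ n) x) ((T ^^ n) y)) = 0"

definition distal_sys :: "('a::metric_space \<Rightarrow> 'a) \<Rightarrow> bool" where
  "distal_sys T \<longleftrightarrow> (\<forall>x y. x \<noteq> y \<longrightarrow> \<not> proximal T x y)"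

definition max_distal_rel :: "('a::metric_space \<Rightarrow> 'a) \<Rightarrow> ('a \<times> 'a) set" where
  "max_distal_rel T = \<Inter> {R. closed R \<and> equiv UNIV R \<and> (\<forall>(x,y)\<in>R. (T x, T y) \<in> R)
                           \<and> {(x,y). proximal T x y} \<subseteq> R}"

definition max_distal_factor ::
  "('a::metric_space \<Rightarrow> 'a) \<Rightarrow> ('b::metric_space \<Rightarrow> 'b) \<Rightarrow> ('a \<Rightarrow> 'b) \<Rightarrow> bool" where
  "max_distal_factor T S \<pi> \<longleftrightarrow> tds S \<and> distal_sys S \<and> continuous_on UNIV \<pi> \<and> surj \<pi>
     \<and> (\<forall>x. \<pi> (T x) = S (\<pi> x)) \<and> {(x,y). \<pi> x = \<pi> y} = max_distal_rel T"

definition almost_one_to_one :: "('a::topological_space \<Rightarrow> 'b) \<Rightarrow> bool" where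
  "almost_one_to_one \<pi> \<longleftrightarrow> closure {x. \<pi> -` {\<pi> x} = {x}} = UNIV"

definition FS :: "(nat \<Rightarrow> nat) \<Rightarrow> nat set" where
  "FS p = {(\<Sum>i\<in>\<alpha>. p i) | \<alpha>. finite \<alpha> \<and> \<alpha> \<noteq> {}}"

definition F_ip :: "nat set set" where
  "F_ip = {A. \<exists>p. (\<forall>i. p i > 0) \<and> FS p \<subseteq> A}"

definition strongly_F_sensitive :: "nat set set \<Rightarrow> ('a::metric_space \<Rightarrow> 'a) \<Rightarrow> bool" where
  "strongly_F_sensitive \<F> T \<longleftrightarrow> (\<exists>\<delta>>0. \<forall>U. open U \<and> U \<noteq> {} \<longrightarrow>
     (\<exists>x\<in>U. \<exists>y\<in>U. {n. dist ((T ^^ n) x) ((T ^^ n) y) > \<delta>} \<in> \<F>))"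

end

theory Submission
  imports Defs
begin

text \<open>
  If T^n separates two nearby points x, y along an IP-set, then some idempotent u in the closure of
  that part of the orbit of T in X^X separates them too; (x, u x) and (y, u y) are proximal, and one
  of these pairs is far apart.

  Conversely, if (x, y) is proximal, both x and y return simultaneously to every neighbourhood of y,
  hence do so along an IP-set. Taking m with T^m y close to x, the points x and T^m y are
  separated along this IP-set: T^n x stays near y while T^n (T^m y) stays near T^m y.

  A fibre of the projection that is a single point has only small fibres around it, which rules out
  long proximal pairs there. If, on the other hand, long proximal pairs are absent from suitable open sets,
  a Baire argument yields a point x0 whose only partner in the closure Q of the proximal relation is x0
  itself. Moving a Q-chain x, y, z along the orbit of x towards x0 shows that (x, z) is proximal. So
  the proximal relation is a closed invariant equivalence relation, it is the kernel of
  the projection, and the whole (dense) orbit of x0 consists of points with trivial fibre.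
\<close>

section \<open>Idempotents in compact semigroups\<close>

text \<open>A finite nonempty subfamily of a chain has its intersection as a member, so the finite
  intersection property holds and compactness applies.\<close>

lemma compact_space_chain_Inter_nonempty:
  assumes X: "compact_space X" and ne: "\<C> \<noteq> {}"
    and clo: "\<And>A. A \<in> \<C> \<Longrightarrow> closedin X A \<and> A \<noteq> {}"
    and chain: "\<And>A B. A \<in> \<C> \<Longrightarrow> B \<in> \<C> \<Longrightarrow> A \<subseteq> B \<or> B \<subseteq> A"
  shows "\<Inter>\<C> \<noteq> {}"
proof -
  have "\<Inter>\<F> \<in> \<C>" if "finite \<F>" "\<F> \<noteq> {}" "\<F> \<subseteq> \<C>" for \<F>
    using that
  proof (induction rule: finite_ne_induct)
    case (insert A \<F>)
    then have "A \<inter> \<Inter>\<F> = A \<or> A \<inter> \<Inter>\<F> = \<Inter>\<F>"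
      using chain[of A "\<Inter>\<F>"] by blast
    then show ?case using insert by auto
  qed simp
  then have "\<Inter>\<F> \<noteq> {}" if "finite \<F>" "\<F> \<subseteq> \<C>" for \<F>
    using that clo by (cases "\<F> = {}") auto
  then show ?thesis
    using X[unfolded compact_space_fip, rule_format, of \<C>] clo by simp
qed

text \<open>A minimal closed subsemigroup \<open>M\<close> exists by Zorn. For \<open>u\<close> in
  \<open>M\<close>, the image of \<open>M\<close> under right multiplication by \<open>u\<close> is
  a closed subsemigroup of \<open>M\<close>, hence equals \<open>M\<close>. So the stabiliser of
  \<open>u\<close> in \<open>M\<close> is a nonempty closed subsemigroup, and it too is all of
  \<open>M\<close>; in particular it contains \<open>u\<close>.\<close>

lemma ellis_numakura:
  assumes X: "compact_space X" "Hausdorff_space X"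
    and assoc: "\<And>p q r. m (m p q) r = m p (m q r)"
    and cont: "\<And>q. q \<in> topspace X \<Longrightarrow> continuous_map X X (\<lambda>p. m p q)"
    and S: "closedin X S" "S \<noteq> {}" "\<And>p q. p \<in> S \<Longrightarrow> q \<in> S \<Longrightarrow> m p q \<in> S"
  obtains u where "u \<in> S" "m u u = u"
proof -
  define \<A> where "\<A> = {A. closedin X A \<and> A \<noteq> {} \<and> A \<subseteq> S \<and> (\<forall>p\<in>A. \<forall>q\<in>A. m p q \<in> A)}"
  have "\<exists>M\<in>\<A>. \<forall>A\<in>\<A>. A \<subseteq> M \<longrightarrow> A = M"
  \<comment> \<open>Sets are ordered by reverse inclusion, so a maximal element in Zorn's sense is a
    minimal subsemigroup.\<close>
  proof (rule predicate_Zorn[where P = "\<lambda>A B. B \<subseteq> A"])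
    show "partial_order_on \<A> (relation_of (\<lambda>A B. B \<subseteq> A) \<A>)"
      by (rule partial_order_on_relation_ofI) auto
  next
    fix C assume C: "C \<in> Chains (relation_of (\<lambda>A B. B \<subseteq> A) \<A>)"
    then have CA: "C \<subseteq> \<A>" and ch: "\<And>A B. A \<in> C \<Longrightarrow> B \<in> C \<Longrightarrow> A \<subseteq> B \<or> B \<subseteq> A"
      unfolding Chains_def relation_of_def by blast+
    show "\<exists>B\<in>\<A>. \<forall>A\<in>C. B \<subseteq> A"
    proof (cases "C = {}")
      case True
      then show ?thesis using S unfolding \<A>_def by blast
    next
      case False
      have "\<Inter>C \<noteq> {}"
        using CA by (intro compact_space_chain_Inter_nonempty[OF X(1) False _ ch]) (auto simp: \<A>_def)
      moreover have "closedin X (\<Inter>C)"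
        using CA False by (intro closedin_Inter) (auto simp: \<A>_def)
      moreover have "\<Inter>C \<subseteq> S"
        using CA False unfolding \<A>_def by blast
      moreover have "\<forall>p\<in>\<Inter>C. \<forall>q\<in>\<Inter>C. m p q \<in> \<Inter>C"
        using CA unfolding \<A>_def by blast
      ultimately have "\<Inter>C \<in> \<A>" unfolding \<A>_def by blast
      then show ?thesis by blast
    qed
  qed
  then obtain M where M: "M \<in> \<A>" and Mmin: "\<And>A. A \<in> \<A> \<Longrightarrow> A \<subseteq> M \<Longrightarrow> A = M"
    by blast
  have Mclo: "closedin X M" and Mmul: "\<And>p q. p \<in> M \<Longrightarrow> q \<in> M \<Longrightarrow> m p q \<in> M" and MS: "M \<subseteq> S"
    using M by (auto simp: \<A>_def)
  obtain u where u: "u \<in> M" using M by (auto simp: \<A>_def)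
  have uX: "u \<in> topspace X" using u Mclo closedin_subset by blast
  let ?Mu = "(\<lambda>p. m p u) ` M"
  have "closedin X ?Mu"
    by (rule compactin_imp_closedin[OF X(2) image_compactin[OF closedin_compact_space[OF X(1) Mclo] cont[OF uX]]])
  moreover have "m p q \<in> ?Mu" if "p \<in> ?Mu" "q \<in> ?Mu" for p q
    using that u Mmul by (auto simp: assoc[symmetric])
  moreover have "?Mu \<subseteq> M" using Mmul u by blast
  ultimately have "?Mu \<in> \<A>" using u MS unfolding \<A>_def by blast
  with Mmin \<open>?Mu \<subseteq> M\<close> have "?Mu = M" by blast
  with u have "u \<in> ?Mu" by simp
  then have ne: "{p \<in> M. m p u = u} \<noteq> {}" by fastforce
  have "closedin X {p \<in> topspace X. m p u \<in> {u}}"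
    by (rule closedin_continuous_map_preimage[OF cont[OF uX]])
      (simp add: uX closedin_Hausdorff_singleton X(2))
  then have "closedin X ({p \<in> topspace X. m p u \<in> {u}} \<inter> M)"
    using Mclo by (rule closedin_Int)
  moreover have "{p \<in> topspace X. m p u \<in> {u}} \<inter> M = {p \<in> M. m p u = u}"
    using closedin_subset[OF Mclo] by blast
  ultimately have "{p \<in> M. m p u = u} \<in> \<A>"
    using ne MS Mmul assoc unfolding \<A>_def by auto
  then have "{p \<in> M. m p u = u} = M" using Mmin by blast
  then show thesis using that u MS by blast
qed

section \<open>Iterates, proximality and uniform visiting times\<close>

lemma funpow_commute: "(T ^^ m) ((T ^^ n) x) = (T ^^ n) ((T ^^ m) x)"
  by (metis add.commute comp_apply funpow_add)

lemma proximal_iff: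
  "proximal T x y \<longleftrightarrow> (\<forall>e>0. \<exists>n. dist ((T ^^ n) x) ((T ^^ n) y) < e)"
proof -
  let ?d = "\<lambda>n. dist ((T ^^ n) x) ((T ^^ n) y)"
  have bdd: "bdd_below (range ?d)" by (rule bdd_belowI[of _ 0]) auto
  have "0 \<le> (INF n. ?d n)" by (rule cINF_greatest) auto
  moreover have zero_iff: "I = 0 \<longleftrightarrow> (\<forall>e>0. I < e)" if "0 \<le> I" for I :: real
    using that by (metis less_irrefl order_le_less)
  ultimately have "proximal T x y \<longleftrightarrow> (\<forall>e>0. (INF n. ?d n) < e)"
    unfolding proximal_def using zero_iff by blast
  then show ?thesis using bdd by (simp add: cINF_less_iff)
qed

lemma proximal_refl: "proximal T x x"
  by (simp add: proximal_def)

lemma proximal_sym: "proximal T x y \<Longrightarrow> proximal T y x"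
  by (simp add: proximal_def dist_commute)

lemma proximal_funpow_D:
  assumes "proximal T ((T ^^ k) x) ((T ^^ k) y)"
  shows "proximal T x y"
  using assms unfolding proximal_iff by (metis comp_apply funpow_add)

lemma continuous_funpow:
  fixes T :: "'a::topological_space \<Rightarrow> 'a"
  assumes "continuous_on UNIV T"
  shows "continuous_on UNIV (T ^^ n)"
proof (induction n)
  case (Suc n)
  then show ?case
    using continuous_on_compose[of UNIV "T ^^ n" T] continuous_on_subset[OF assms] by simp
qed (simp add: id_def)

text \<open>Compactness makes each iterate uniformly continuous; the minimum of the finitely many
  moduli serves all times up to \<open>N\<close>.\<close>

lemma funpow_equicontinuous:
  fixes T :: "'a::metric_space \<Rightarrow> 'a"
  assumes "tds T" "e > 0"
  obtains r where "r > 0" "\<And>k a b. k \<le> N \<Longrightarrow> dist a b < r \<Longrightarrow> dist ((T ^^ k) a) ((T ^^ k) b) < e"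
proof -
  have "\<exists>r>0. \<forall>a b. dist a b < r \<longrightarrow> dist ((T ^^ k) a) ((T ^^ k) b) < e" for k
    using compact_uniformly_continuous[OF continuous_funpow, of T k] assms
    unfolding tds_def uniformly_continuous_on_def by (metis UNIV_I dist_commute)
  then obtain r where r: "\<And>k. r k > 0"
    "\<And>k a b. dist a b < r k \<Longrightarrow> dist ((T ^^ k) a) ((T ^^ k) b) < e" by metis
  show thesis
    by (rule that[of "Min (r ` {..N})"]) (use r in auto)
qed

lemma minimal_orbit_meets_open:
  assumes "minimal_sys T" "open W" "W \<noteq> {}"
  obtains k where "(T ^^ k) x \<in> W"
proof -
  have "W \<inter> closure (range (\<lambda>n. (T ^^ n) x)) \<noteq> {}"
    using assms by (simp add: minimal_sys_def)
  then show thesis using that open_Int_closure_eq_empty[OF assms(2)] by blast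
qed

text \<open>The preimages of \<open>W\<close> under the iterates cover the space, and a finite
  subcover bounds the waiting time.\<close>

lemma minimal_uniform_visits:
  fixes T :: "'a::metric_space \<Rightarrow> 'a"
  assumes "tds T" "minimal_sys T" "open W" "W \<noteq> {}"
  obtains N where "\<And>x. \<exists>k\<le>N. (T ^^ k) x \<in> W"
proof -
  have "compact (UNIV :: 'a set)" and c: "continuous_on UNIV T"
    using assms by (auto simp: tds_def)
  moreover have "open ((T ^^ k) -` W)" for k
    by (rule open_vimage[OF assms(3) continuous_funpow[OF c]])
  moreover have "UNIV \<subseteq> (\<Union>k\<in>UNIV. (T ^^ k) -` W)"
  proof
    fix x
    obtain k where "(T ^^ k) x \<in> W" using minimal_orbit_meets_open[OF assms(2-4)] .
    then show "x \<in> (\<Union>k\<in>UNIV. (T ^^ k) -` W)" by blast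
  qed
  ultimately obtain K where K: "finite K" "UNIV \<subseteq> (\<Union>k\<in>K. (T ^^ k) -` W)"
    using compactE_image[of UNIV UNIV "\<lambda>k. (T ^^ k) -` W"] by metis
  show thesis
  proof (rule that[of "Max K"])
    fix x
    obtain k where "k \<in> K" "(T ^^ k) x \<in> W" using K by blast
    then show "\<exists>k\<le>Max K. (T ^^ k) x \<in> W" using K by (meson Max_ge)
  qed
qed

lemma proximal_funpow:
  assumes "tds T" "proximal T x y"
  shows "proximal T ((T ^^ k) x) ((T ^^ k) y)"
  unfolding proximal_iff
proof (intro allI impI)
  fix e :: real assume "e > 0"
  with assms(1) obtain r where "r > 0"
    and r: "\<And>j a b. j \<le> k \<Longrightarrow> dist a b < r \<Longrightarrow> dist ((T ^^ j) a) ((T ^^ j) b) < e"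
    using funpow_equicontinuous by blast
  then obtain n where "dist ((T ^^ n) x) ((T ^^ n) y) < r"
    using assms(2) unfolding proximal_iff by blast
  then show "\<exists>n. dist ((T ^^ n) ((T ^^ k) x)) ((T ^^ n) ((T ^^ k) y)) < e"
    using r[of k] by (metis funpow_commute order_refl)
qed

section \<open>IP-sets of simultaneous returns\<close>

text \<open>Proximality makes the two orbits so close at some time that they stay within
  \<open>e\<close> for the next \<open>N\<close> steps; during these steps the orbit of
  \<open>y\<close> visits the ball around \<open>y\<close>, and that of \<open>x\<close> is dragged
  along.\<close>

lemma proximal_simultaneous_return:
  assumes T: "tds T" "minimal_sys T" and prox: "proximal T x y" and V: "open V" "y \<in> V"
  obtains n where "n > 0" "(T ^^ n) x \<in> V" "(T ^^ n) y \<in> V"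
proof -
  obtain e where e: "e > 0" "ball y (2 * e) \<subseteq> V"
    using V by (metis open_contains_ball_eq field_sum_of_halves mult_2 half_gt_zero)
  obtain N where N: "\<And>z. \<exists>k\<le>N. (T ^^ k) z \<in> ball y e"
    using minimal_uniform_visits[OF T, of "ball y e"] e by auto
  obtain r where "r > 0"
    and r: "\<And>j a b. j \<le> N \<Longrightarrow> dist a b < r \<Longrightarrow> dist ((T ^^ j) a) ((T ^^ j) b) < e"
    using funpow_equicontinuous[OF T(1) e(1)] by blast
  \<comment> \<open>Starting one step later makes the return time \<open>k + m + 1\<close>
    positive.\<close>
  have "proximal T ((T ^^ 1) x) ((T ^^ 1) y)" by (rule proximal_funpow[OF T(1) prox])
  then obtain m where m: "dist ((T ^^ m) ((T ^^ 1) x)) ((T ^^ m) ((T ^^ 1) y)) < r"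
    using \<open>r > 0\<close> unfolding proximal_iff by blast
  obtain k where k: "k \<le> N" "(T ^^ k) ((T ^^ m) ((T ^^ 1) y)) \<in> ball y e" using N by blast
  have "dist ((T ^^ k) ((T ^^ m) ((T ^^ 1) x))) ((T ^^ k) ((T ^^ m) ((T ^^ 1) y))) < e"
    using r[OF k(1) m] .
  with k(2) have "dist y ((T ^^ k) ((T ^^ m) ((T ^^ 1) x))) < 2 * e"
    by (metis mem_ball mult_2 dist_commute dist_triangle_less_add)
  moreover have "dist y ((T ^^ k) ((T ^^ m) ((T ^^ 1) y))) < 2 * e"
    using k(2) e by simp
  ultimately show thesis
    using e(2) that[of "k + m + 1"] unfolding funpow_add comp_apply by (auto simp: subset_iff)
qed

lemma IP_simultaneous_return:
  fixes T :: "'a::topological_space \<Rightarrow> 'a"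
  assumes cont: "continuous_on UNIV T" and V0: "open V0" "y \<in> V0"
    and ret: "\<And>V. open V \<Longrightarrow> y \<in> V \<Longrightarrow> \<exists>n>0. (T ^^ n) x \<in> V \<and> (T ^^ n) y \<in> V"
  obtains p where "\<And>i. p i > 0" "\<And>n. n \<in> FS p \<Longrightarrow> (T ^^ n) x \<in> V0 \<and> (T ^^ n) y \<in> V0"
proof -
  define P where "P = (\<lambda>(V, n). open V \<and> y \<in> V \<and> V \<subseteq> V0 \<and> n > 0 \<and> (T ^^ n) x \<in> V \<and> (T ^^ n) y \<in> V)"
  define Q where "Q = (\<lambda>(V, n) (V', n' :: nat). V' = V \<inter> (T ^^ n) -` V)"
  have "\<exists>f. \<forall>k::nat. P (f k) \<and> Q (f k) (f (Suc k))"
  proof (rule dependent_nat_choice[where P = "\<lambda>_. P" and Q = "\<lambda>_. Q"])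
    show "\<exists>a. P a" using ret[OF V0] V0 unfolding P_def by auto
  next
    fix a k assume "P a"
    obtain V n where a: "a = (V, n)" by fastforce
    \<comment> \<open>Since \<open>y\<close> itself returns to \<open>V\<close> at time
      \<open>n\<close>, this set is again a neighbourhood of \<open>y\<close>, and the recursion can
      go on.\<close>
    let ?V = "V \<inter> (T ^^ n) -` V"
    have "open ?V" "y \<in> ?V" "?V \<subseteq> V0"
      using \<open>P a\<close> continuous_funpow[OF cont, of n] by (auto simp: a P_def intro: open_vimage)
    then show "\<exists>b. P b \<and> Q a b"
      using ret[of ?V] unfolding P_def Q_def a by auto
  qed
  then obtain f where f: "\<And>k. P (f k)" "\<And>k. Q (f k) (f (Suc k))" by blast
  \<comment> \<open>The neighbourhoods shrink by V (Suc k) = V k \<inter> T^-(p k) (V k), so summands may be applied in decreasing order of index.\<close>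
  define V where "V = fst \<circ> f"
  define p where "p = snd \<circ> f"
  have P: "V k \<subseteq> V0" "p k > 0" "(T ^^ p k) x \<in> V k" "(T ^^ p k) y \<in> V k" for k
    using f(1)[of k] by (auto simp: P_def V_def p_def split: prod.splits)
  have V_Suc: "V (Suc k) = V k \<inter> (T ^^ p k) -` V k" for k
    using f(2)[of k] by (auto simp: Q_def V_def p_def split: prod.splits)
  have step: "(T ^^ (\<Sum>i\<in>\<alpha>. p i)) z \<in> V0" if "\<alpha> \<subseteq> {..<k}" "z \<in> V k" for \<alpha> k z
    using that
  proof (induction k arbitrary: \<alpha> z)
    case 0
    then show ?case using P(1) by auto
  next
    case (Suc k)
    have sub: "\<alpha> - {k} \<subseteq> {..<k}" using Suc.prems(1) by auto
    show ?case
    proof (cases "k \<in> \<alpha>")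
      case True
      then have "(\<Sum>i\<in>\<alpha>. p i) = (\<Sum>i\<in>\<alpha> - {k}. p i) + p k"
        using Suc.prems(1) finite_subset by (metis sum.remove finite_lessThan add.commute)
      then show ?thesis
        using Suc.IH[OF sub, of "(T ^^ p k) z"] Suc.prems(2) by (simp add: funpow_add V_Suc)
    next
      case False
      then show ?thesis using Suc.IH[of \<alpha> z] Suc.prems sub by (simp add: V_Suc)
    qed
  qed
  have "(T ^^ n) x \<in> V0 \<and> (T ^^ n) y \<in> V0" if n: "n \<in> FS p" for n
  proof -
    obtain \<alpha> where \<alpha>: "finite \<alpha>" "\<alpha> \<noteq> {}" "n = (\<Sum>i\<in>\<alpha>. p i)"
      using n unfolding FS_def by blast
    \<comment> \<open>The summand with the largest index acts first: it carries \<open>x\<close>,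
      which need not lie in any of the neighbourhoods, into \<open>V k\<close>, where
      \<open>step\<close> takes over.\<close>
    define k where "k = Max \<alpha>"
    have k: "k \<in> \<alpha>" "\<alpha> - {k} \<subseteq> {..<k}"
      using \<alpha> Max_in[of \<alpha>] Max_ge[of \<alpha>] by (auto simp: k_def order.strict_iff_order)
    have "n = (\<Sum>i\<in>\<alpha> - {k}. p i) + p k"
      using \<alpha> sum.remove[of \<alpha> k p] k(1) by simp
    then show ?thesis
      using step[OF k(2) P(3)] step[OF k(2) P(4)] by (simp only: funpow_add comp_apply)
  qed
  with P(2) show thesis using that by blast
qed

lemma proximal_imp_strongly_IP_sensitive:
  fixes T :: "'a::metric_space \<Rightarrow> 'a"
  assumes T: "tds T" "minimal_sys T" and "\<delta> > 0"
    and prox: "\<And>U. open U \<Longrightarrow> U \<noteq> {} \<Longrightarrow> \<exists>x\<in>U. \<exists>y. proximal T x y \<and> dist x y > \<delta>"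
  shows "strongly_F_sensitive F_ip T"
  unfolding strongly_F_sensitive_def
proof (intro exI conjI allI impI)
  show "\<delta> / 2 > 0" using \<open>\<delta> > 0\<close> by simp
  fix U :: "'a set" assume "open U \<and> U \<noteq> {}"
  then obtain u0 r0 where r0: "r0 > 0" "ball u0 r0 \<subseteq> U" by (meson ex_in_conv openE)
  \<comment> \<open>The estimate below replaces \<open>x\<close> by \<open>u0\<close>,
    \<open>u0\<close> by the image of \<open>T^m y\<close>, and \<open>y\<close> by the image of
    \<open>x\<close>; three errors below \<delta>/8 leave more than \<delta>/2.\<close>
  define r where "r = min r0 (\<delta> / 8)"
  have r: "r > 0" "ball u0 r \<subseteq> U" "r \<le> \<delta> / 8"
    using r0 \<open>\<delta> > 0\<close> by (auto simp: r_def)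
  have ne: "ball u0 r \<noteq> {}" using r by simp
  then obtain x y where x: "x \<in> ball u0 r" and xy: "proximal T x y" "dist x y > \<delta>"
    using prox[of "ball u0 r"] by auto
  obtain m where m: "(T ^^ m) y \<in> ball u0 r"
    using minimal_orbit_meets_open[OF T(2) open_ball ne] .
  \<comment> \<open>A return of \<open>x\<close> to \<open>V\<close> puts \<open>T^n x\<close> near
    \<open>y\<close>; a return of \<open>y\<close> to \<open>V\<close> puts
    \<open>T^m (T^n y)\<close>, which is \<open>T^n (T^m y)\<close>, back into the ball around
    \<open>u0\<close>.\<close>
  define V where "V = ball y (\<delta> / 8) \<inter> (T ^^ m) -` ball u0 r"
  have cont: "continuous_on UNIV T" using T by (simp add: tds_def)
  have V: "open V" "y \<in> V"
    using m \<open>\<delta> > 0\<close> by (auto simp: V_def intro!: open_vimage continuous_funpow cont)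
  obtain p where p: "\<And>i. p i > 0" "\<And>n. n \<in> FS p \<Longrightarrow> (T ^^ n) x \<in> V \<and> (T ^^ n) y \<in> V"
    using IP_simultaneous_return[OF cont V] proximal_simultaneous_return[OF T xy(1)] by metis
  have "dist ((T ^^ n) x) ((T ^^ n) ((T ^^ m) y)) > \<delta> / 2" if "n \<in> FS p" for n
  proof -
    have "dist y ((T ^^ n) x) < \<delta> / 8" using p(2)[OF that] by (simp add: V_def)
    moreover have "(T ^^ n) ((T ^^ m) y) \<in> ball u0 r"
      using p(2)[OF that] by (simp add: V_def funpow_commute[of n])
    then have "dist u0 ((T ^^ n) ((T ^^ m) y)) < \<delta> / 8" using r by simp
    moreover have "dist u0 x < \<delta> / 8" using x r by simp
    ultimately show ?thesis
      using xy(2) by metric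
  qed
  then have "{n. dist ((T ^^ n) x) ((T ^^ n) ((T ^^ m) y)) > \<delta> / 2} \<in> F_ip"
    using p(1) unfolding F_ip_def by blast
  then show "\<exists>x\<in>U. \<exists>y\<in>U. {n. dist ((T ^^ n) x) ((T ^^ n) y) > \<delta> / 2} \<in> F_ip"
    using x m r by blast
qed

section \<open>Idempotent limits of iterates along IP-sets\<close>

lemma idempotent_in_closure_FS:
  fixes T :: "'a::metric_space \<Rightarrow> 'a"
  assumes T: "tds T"
  obtains u where "u \<in> closure ((\<lambda>n. T ^^ n) ` FS p)" "u \<circ> u = u"
proof -
  \<comment> \<open>The closure of a single FS-set need not be a semigroup; the intersection over its tails is.\<close>
  define F where "F k = (\<lambda>\<alpha>. T ^^ (\<Sum>i\<in>\<alpha>. p i)) ` {\<alpha>. finite \<alpha> \<and> \<alpha> \<noteq> {} \<and> \<alpha> \<subseteq> {k..}}" for k :: nat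
  define S where "S = (\<Inter>k. closure (F k))"
  have cont: "continuous_on UNIV T" using T by (simp add: tds_def)
  \<comment> \<open>The topology of the function type is that of pointwise convergence, so
    Tychonoff's theorem makes it compact.\<close>
  have "compact_space (product_topology (\<lambda>_::'a. euclidean :: 'a topology) UNIV)"
    unfolding compact_space_product_topology using T by (simp add: tds_def compact_space_def)
  then have comp: "compact_space (euclidean :: ('a \<Rightarrow> 'a) topology)"
    by (simp add: euclidean_product_topology)
  have "Hausdorff_space (product_topology (\<lambda>_::'a. euclidean :: 'a topology) UNIV)"
    by (simp add: Hausdorff_space_product_topology)
  then have haus: "Hausdorff_space (euclidean :: ('a \<Rightarrow> 'a) topology)"
    by (simp add: euclidean_product_topology)
  have cont_right: "continuous_on UNIV (\<lambda>f :: 'a \<Rightarrow> 'a. f \<circ> q)" for q :: "'a \<Rightarrow> 'a"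
    unfolding comp_def by (intro continuous_on_coordinatewise_then_product continuous_on_product_coordinates)
  have cont_left: "continuous_on UNIV (\<lambda>f :: 'a \<Rightarrow> 'a. T ^^ n \<circ> f)" for n
    unfolding comp_def
    by (intro continuous_on_coordinatewise_then_product
        continuous_on_compose2[OF continuous_funpow[OF cont, of n] continuous_on_product_coordinates]) simp
  have F_anti: "F l \<subseteq> F k" if "k \<le> l" for k l
    using that unfolding F_def by fastforce
  have F_ne: "F k \<noteq> {}" for k
    unfolding F_def by (auto intro!: exI[of _ "{k}"])
  have "S \<noteq> {}"
    unfolding S_def
  proof (rule compact_space_chain_Inter_nonempty[OF comp])
    fix A B assume "A \<in> range (\<lambda>k. closure (F k))" "B \<in> range (\<lambda>k. closure (F k))"
    then obtain k l where "A = closure (F k)" "B = closure (F l)" by blast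
    then show "A \<subseteq> B \<or> B \<subseteq> A"
      using closure_mono[OF F_anti, of k l] closure_mono[OF F_anti, of l k] by (cases k l rule: le_cases) auto
  qed (use F_ne in auto)
  moreover have "closedin euclidean S"
    by (auto simp: S_def)
  moreover have "f \<circ> g \<in> S" if f: "f \<in> S" and g: "g \<in> S" for f g
    unfolding S_def
  proof
    fix k
    \<comment> \<open>The two limits are taken one after the other: here in the right factor, with
      \<open>h\<close> a fixed iterate and hence continuous; afterwards in the left factor, as
      composing with a fixed \<open>g\<close> on the right is continuous for pointwise
      convergence.\<close>
    have "h \<circ> g \<in> closure (F k)" if "h \<in> F k" for h
    proof -
      obtain \<alpha> where \<alpha>: "finite \<alpha>" "\<alpha> \<noteq> {}" "\<alpha> \<subseteq> {k..}" "h = T ^^ (\<Sum>i\<in>\<alpha>. p i)"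
        using \<open>h \<in> F k\<close> unfolding F_def by blast
      \<comment> \<open>Index sets beyond \<open>Max \<alpha>\<close> are disjoint from
        \<open>\<alpha>\<close>, so composing the iterates gives the sum over the union.\<close>
      let ?l = "Suc (Max \<alpha>)"
      have "T ^^ (\<Sum>i\<in>\<alpha>. p i) \<circ> T ^^ (\<Sum>i\<in>\<beta>. p i) \<in> F k"
        if "finite \<beta>" "\<beta> \<noteq> {}" "\<beta> \<subseteq> {?l..}" for \<beta>
      proof -
        have lt: "i < j" if "i \<in> \<alpha>" "j \<in> \<beta>" for i j
          using that \<alpha>(1) \<open>\<beta> \<subseteq> {?l..}\<close> by (meson Max_ge Suc_le_lessD atLeast_iff le_less_trans subsetD)
        then have "\<alpha> \<inter> \<beta> = {}" by blast
        then have "T ^^ (\<Sum>i\<in>\<alpha>. p i) \<circ> T ^^ (\<Sum>i\<in>\<beta>. p i) = T ^^ (\<Sum>i\<in>\<alpha> \<union> \<beta>. p i)"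
          using \<alpha>(1) that(1) by (simp add: sum.union_disjoint funpow_add)
        moreover have "\<beta> \<subseteq> {k..}"
          using lt \<alpha>(2,3) by (metis all_not_in_conv atLeast_iff less_imp_le order_trans subset_iff)
        ultimately show ?thesis
          using \<alpha> that(1) unfolding F_def by auto
      qed
      then have "(\<lambda>f. h \<circ> f) ` F ?l \<subseteq> F k"
        unfolding \<alpha>(4) F_def[of ?l] by blast
      then have "(\<lambda>f. h \<circ> f) ` closure (F ?l) \<subseteq> closure (F k)"
        using image_closure_subset[OF continuous_on_subset[OF cont_left subset_UNIV] closed_closure]
          closure_subset \<alpha>(4) by blast
      then show ?thesis
        using g unfolding S_def by blast
    qed
    then have "(\<lambda>f. f \<circ> g) ` closure (F k) \<subseteq> closure (F k)"
      by (intro image_closure_subset continuous_on_subset[OF cont_right]) auto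
    then show "f \<circ> g \<in> closure (F k)"
      using f unfolding S_def by blast
  qed
  ultimately obtain u where u: "u \<in> S" "u \<circ> u = u"
    using ellis_numakura[of euclidean "(\<circ>)" S, OF comp haus] cont_right by (auto simp: comp_assoc)
  have "F 0 \<subseteq> (\<lambda>n. T ^^ n) ` FS p"
    by (auto simp: F_def FS_def)
  then have "u \<in> closure ((\<lambda>n. T ^^ n) ` FS p)"
    using u(1) closure_mono unfolding S_def by blast
  with u(2) show thesis using that by blast
qed

text \<open>Idempotence says that \<open>u\<close> sends \<open>x\<close> and \<open>u x\<close> to
  the same point, and some iterate of \<open>T\<close> is close to \<open>u\<close> at both
  points.\<close>

lemma idempotent_limit_proximal:
  fixes T :: "'a::metric_space \<Rightarrow> 'a"
  assumes u: "u \<in> closure (range (\<lambda>n. T ^^ n))" "u \<circ> u = u"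
  shows "proximal T x (u x)"
  unfolding proximal_iff
proof (intro allI impI)
  fix e :: real assume "e > 0"
  have "continuous_on UNIV (\<lambda>f :: 'a \<Rightarrow> 'a. dist (f x) (f (u x)))"
    by (intro continuous_intros continuous_on_product_coordinates)
  then have "open ((\<lambda>f :: 'a \<Rightarrow> 'a. dist (f x) (f (u x))) -` {..<e})"
    by (intro open_vimage) auto
  moreover have "u \<in> (\<lambda>f :: 'a \<Rightarrow> 'a. dist (f x) (f (u x))) -` {..<e}"
    using \<open>e > 0\<close> fun_cong[OF u(2), of x] by simp
  ultimately show "\<exists>n. dist ((T ^^ n) x) ((T ^^ n) (u x)) < e"
    using u(1) unfolding closure_iff_nhds_not_empty by fastforce
qed

lemma strongly_IP_sensitive_imp_proximal:
  fixes T :: "'a::metric_space \<Rightarrow> 'a"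
  assumes T: "tds T" and sens: "strongly_F_sensitive F_ip T"
  shows "\<exists>\<delta>>0. \<forall>U. open U \<and> U \<noteq> {} \<longrightarrow> (\<exists>x\<in>U. \<exists>y. proximal T x y \<and> dist x y > \<delta>)"
proof -
  obtain \<delta> where \<delta>: "\<delta> > 0" and
    sens: "\<And>U. open U \<Longrightarrow> U \<noteq> {} \<Longrightarrow> \<exists>x\<in>U. \<exists>y\<in>U. {n. dist ((T ^^ n) x) ((T ^^ n) y) > \<delta>} \<in> F_ip"
    using sens unfolding strongly_F_sensitive_def by blast
  have "\<exists>x\<in>U. \<exists>y. proximal T x y \<and> dist x y > \<delta> / 4" if U: "open U" "U \<noteq> {}" for U
  proof -
    obtain u0 r0 where r0: "r0 > 0" "ball u0 r0 \<subseteq> U"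
      using U by (meson ex_in_conv openE)
    define r where "r = min r0 (\<delta> / 8)"
    have r: "r > 0" "ball u0 r \<subseteq> U" "r \<le> \<delta> / 8"
      using r0 \<delta> by (auto simp: r_def)
    then have "ball u0 r \<noteq> {}" by simp
    then obtain x y p where xy: "x \<in> ball u0 r" "y \<in> ball u0 r"
      and p: "FS p \<subseteq> {n. dist ((T ^^ n) x) ((T ^^ n) y) > \<delta>}"
      using sens[of "ball u0 r"] unfolding F_ip_def by auto
    obtain u where u: "u \<in> closure ((\<lambda>n. T ^^ n) ` FS p)" "u \<circ> u = u"
      using idempotent_in_closure_FS[OF T] .
    have "u \<in> closure (range (\<lambda>n. T ^^ n))"
      by (rule subsetD[OF closure_mono u(1)]) auto
    then have prox: "proximal T z (u z)" for z
      by (rule idempotent_limit_proximal[OF _ u(2)])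
    have "continuous_on UNIV (\<lambda>f :: 'a \<Rightarrow> 'a. dist (f x) (f y))"
      by (intro continuous_intros continuous_on_product_coordinates)
    \<comment> \<open>In the limit the strict bound along the IP-set survives as a weak one.\<close>
    then have "closed ((\<lambda>f :: 'a \<Rightarrow> 'a. dist (f x) (f y)) -` {\<delta>..})"
      by (intro closed_vimage) auto
    moreover have "(\<lambda>n. T ^^ n) ` FS p \<subseteq> (\<lambda>f :: 'a \<Rightarrow> 'a. dist (f x) (f y)) -` {\<delta>..}"
      using p by fastforce
    ultimately have "u \<in> (\<lambda>f :: 'a \<Rightarrow> 'a. dist (f x) (f y)) -` {\<delta>..}"
      by (intro subsetD[OF closure_minimal u(1)])
    then have far: "dist (u x) (u y) \<ge> \<delta>" by simp
    \<comment> \<open>The points \<open>x\<close> and \<open>y\<close> are less than \<delta>/4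
      apart, so moving both by at most \<delta>/4 could not separate them by \<delta>.\<close>
    have "dist u0 x < \<delta> / 8" "dist u0 y < \<delta> / 8" using xy r by auto
    with far have "dist x (u x) > \<delta> / 4 \<or> dist y (u y) > \<delta> / 4"
      by metric
    then show ?thesis using prox xy r by blast
  qed
  then show ?thesis using \<delta> by (intro exI[of _ "\<delta> / 4"]) auto
qed

section \<open>Irreducibility of minimal maps\<close>

text \<open>If \<open>A\<close> maps onto the space, preimages can be chosen in \<open>A\<close>
  repeatedly, which yields arbitrarily long orbit segments inside \<open>A\<close>. A nonempty open
  complement would be visited within a bounded time.\<close>

lemma minimal_irreducible:
  fixes T :: "'a::metric_space \<Rightarrow> 'a"
  assumes T: "tds T" "minimal_sys T" and A: "closed A" "T ` A = UNIV"
  shows "A = UNIV"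
proof (rule ccontr)
  assume "A \<noteq> UNIV"
  then obtain N where N: "\<And>x. \<exists>k\<le>N. (T ^^ k) x \<in> - A"
    using minimal_uniform_visits[OF T, of "- A"] A(1) by (auto simp: open_Compl)
  have "\<exists>x. \<forall>k\<le>n. (T ^^ k) x \<in> A" for n
  proof (induction n)
    case 0
    then show ?case using A(2) by auto
  next
    case (Suc n)
    then obtain x where x: "\<And>k. k \<le> n \<Longrightarrow> (T ^^ k) x \<in> A" by blast
    obtain z where z: "z \<in> A" "T z = x" using A(2) by (metis UNIV_I imageE)
    have "(T ^^ k) z \<in> A" if "k \<le> Suc n" for k
      using x z that by (cases k) (auto simp: funpow_swap1[symmetric] funpow_Suc_right simp del: funpow.simps)
    then show ?case by blast
  qed
  with N show False by blast
qed

text \<open>A substitute for openness of \<open>T\<close>: the points with all preimages in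
  \<open>U\<close> form an open set by compactness, nonempty by irreducibility.\<close>

lemma minimal_open_contains_preimage:
  fixes T :: "'a::metric_space \<Rightarrow> 'a"
  assumes T: "tds T" "minimal_sys T" and U: "open U" "U \<noteq> {}"
  obtains V where "open V" "V \<noteq> {}" "T -` V \<subseteq> U"
proof
  have "compact (UNIV :: 'a set)" "continuous_on UNIV T" using T by (auto simp: tds_def)
  then have "compact (T ` (- U))"
    using U(1) by (metis compact_Int_closed closed_Compl compact_continuous_image continuous_on_subset
        inf_top_left subset_UNIV)
  then show "open (- T ` (- U))" by (simp add: compact_imp_closed open_Compl)
  show "- T ` (- U) \<noteq> {}"
    using minimal_irreducible[OF T, of "- U"] U by auto
qed auto

lemma minimal_open_preimages_along_orbit:
  fixes T :: "'a::metric_space \<Rightarrow> 'a"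
  assumes T: "tds T" "minimal_sys T" and U: "open U" "U \<noteq> {}"
  shows "\<exists>x V. \<forall>k\<le>N. open (V k) \<and> (T ^^ k) x \<in> V k \<and> (T ^^ k) -` V k \<subseteq> U"
  using U
proof (induction N arbitrary: U)
  case 0
  then obtain x where "x \<in> U" by blast
  then show ?case using 0 by (intro exI[of _ x] exI[of _ "\<lambda>_. U"]) auto
next
  case (Suc N)
  obtain U' where U': "open U'" "U' \<noteq> {}" "T -` U' \<subseteq> U"
    using minimal_open_contains_preimage[OF T Suc.prems] .
  obtain x' V' where V': "\<And>k. k \<le> N \<Longrightarrow> open (V' k) \<and> (T ^^ k) x' \<in> V' k \<and> (T ^^ k) -` V' k \<subseteq> U'"
    using Suc.IH[OF U'(1,2)] by blast
  obtain x where x: "x' = T x" using T(1) unfolding tds_def by (metis surjD)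
  \<comment> \<open>Time 0 for \<open>x'\<close> places it in \<open>U'\<close>, so its preimage
    \<open>x\<close> lies in \<open>U\<close>, as time 0 for \<open>x\<close> demands.\<close>
  have "x' \<in> U'" using V'[of 0] by auto
  define V where "V k = (case k of 0 \<Rightarrow> U | Suc j \<Rightarrow> V' j)" for k
  have "open (V k) \<and> (T ^^ k) x \<in> V k \<and> (T ^^ k) -` V k \<subseteq> U" if "k \<le> Suc N" for k
  proof (cases k)
    case 0
    then show ?thesis using Suc.prems(1) U'(3) \<open>x' \<in> U'\<close> x by (auto simp: V_def)
  next
    case (Suc j)
    have "(T ^^ Suc j) z = (T ^^ j) (T z)" for z by (simp add: funpow_swap1)
    then show ?thesis
      using V'[of j] that U'(3) x unfolding Suc V_def
      by (auto simp: vimage_def subset_iff simp del: funpow.simps)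
  qed
  then show ?case by blast
qed

section \<open>Fibres of closed relations\<close>

lemma closed_fst_image:
  fixes C :: "('a::metric_space \<times> 'b::metric_space) set"
  assumes "compact (UNIV :: 'a set)" "compact (UNIV :: 'b set)" "closed C"
  shows "closed (fst ` C)"
proof -
  have "compact C"
    using compact_Int_closed[OF compact_Times[OF assms(1,2)] assms(3)] by simp
  then show ?thesis
    by (intro compact_imp_closed compact_continuous_image continuous_intros)
qed

lemma closed_far_pairs:
  fixes C :: "('a::metric_space \<times> 'a) set"
  assumes "compact (UNIV :: 'a set)" "closed C"
  shows "closed {x. \<exists>y. (x, y) \<in> C \<and> e \<le> dist x y}"
proof -
  have "closed {p :: 'a \<times> 'a. e \<le> dist (fst p) (snd p)}"
    by (intro closed_Collect_le continuous_intros)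
  then have "closed (fst ` (C \<inter> {p. e \<le> dist (fst p) (snd p)}))"
    using assms by (intro closed_fst_image closed_Int)
  moreover have "fst ` (C \<inter> {p. e \<le> dist (fst p) (snd p)}) = {x. \<exists>y. (x, y) \<in> C \<and> e \<le> dist x y}"
    by force
  ultimately show ?thesis by simp
qed

text \<open>Upper semicontinuity of fibres: the points with a partner at distance at least
  \<open>e\<close> form a closed set, which misses \<open>x0\<close>.\<close>

lemma fibres_small_near_singleton_fibre:
  fixes C :: "('a::metric_space \<times> 'a) set"
  assumes "compact (UNIV :: 'a set)" "closed C" and "\<And>y. (x0, y) \<in> C \<Longrightarrow> y = x0" and "e > 0"
  obtains U where "open U" "x0 \<in> U" "\<And>x y. x \<in> U \<Longrightarrow> (x, y) \<in> C \<Longrightarrow> dist x y < e"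
proof
  show "open (- {x. \<exists>y. (x, y) \<in> C \<and> e \<le> dist x y})"
    using closed_far_pairs[OF assms(1,2)] by (simp add: open_Compl)
  show "x0 \<in> - {x. \<exists>y. (x, y) \<in> C \<and> e \<le> dist x y}"
    using assms(3,4) by force
qed force

section \<open>The closure of the proximal relation\<close>

text \<open>The proximal relation need be neither closed nor transitive; its closure admits
  compactness and Baire arguments.\<close>

definition proximal_closure :: "('a::metric_space \<Rightarrow> 'a) \<Rightarrow> ('a \<times> 'a) set" where
  "proximal_closure T = closure {(x, y). proximal T x y}"

lemma proximal_closure_funpow:
  fixes T :: "'a::metric_space \<Rightarrow> 'a"
  assumes T: "tds T" and xy: "(x, y) \<in> proximal_closure T"
  shows "((T ^^ k) x, (T ^^ k) y) \<in> proximal_closure T"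
proof -
  let ?P = "{(x, y). proximal T x y}"
  have c: "continuous_on UNIV (T ^^ k)"
    using T by (simp add: tds_def continuous_funpow)
  have "map_prod (T ^^ k) (T ^^ k) ` closure ?P \<subseteq> closure ?P"
  proof (rule image_closure_subset)
    have "continuous_on UNIV (\<lambda>p. ((T ^^ k) (fst p), (T ^^ k) (snd p)))"
      by (intro continuous_intros continuous_on_compose2[OF c]) auto
    then show "continuous_on (closure ?P) (map_prod (T ^^ k) (T ^^ k))"
      unfolding map_prod_def case_prod_unfold by (rule continuous_on_subset) simp
    show "map_prod (T ^^ k) (T ^^ k) ` ?P \<subseteq> closure ?P"
      using proximal_funpow[OF T] closure_subset by fastforce
  qed simp
  then show ?thesis
    using xy unfolding proximal_closure_def by (metis image_subset_iff map_prod_simp)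
qed

text \<open>Otherwise Baire gives an open \<open>W\<close> all of whose points have partners at
  distance at least \<open>e\<close>. Orbits from \<open>U\<close> reach \<open>W\<close> in bounded
  time, so equicontinuity forbids the proximal pairs starting in \<open>U\<close> to be arbitrarily
  short.\<close>

lemma ex_singleton_proximal_closure_fibre:
  fixes T :: "'a::metric_space \<Rightarrow> 'a"
  assumes T: "tds T" "minimal_sys T"
    and small: "\<And>\<delta>. \<delta> > 0 \<Longrightarrow> \<exists>U. open U \<and> U \<noteq> {} \<and> (\<forall>x\<in>U. \<forall>y. proximal T x y \<longrightarrow> dist x y \<le> \<delta>)"
  shows "\<exists>x0. \<forall>y. (x0, y) \<in> proximal_closure T \<longrightarrow> y = x0"
proof (rule ccontr)
  assume no: "\<nexists>x0. \<forall>y. (x0, y) \<in> proximal_closure T \<longrightarrow> y = x0"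
  have comp: "compact (UNIV :: 'a set)" using T by (simp add: tds_def)
  define F where "F n = {x. \<exists>y. (x, y) \<in> proximal_closure T \<and> 1 / real (Suc n) \<le> dist x y}" for n
  have closedF: "closed (F n)" for n
    unfolding F_def by (rule closed_far_pairs[OF comp]) (simp add: proximal_closure_def)
  have "\<exists>n. x \<in> F n" for x
  proof -
    obtain y where y: "(x, y) \<in> proximal_closure T" "y \<noteq> x" using no by blast
    then obtain n where "1 / real (Suc n) < dist x y"
      using nat_approx_posE[of "dist x y"] by auto
    with y(1) show ?thesis unfolding F_def by (auto intro!: exI[of _ n])
  qed
  then have "(\<Union>n. F n) = UNIV" by blast
  moreover have "interior (\<Union>n. F n) = {}" if "\<And>n. interior (F n) = {}"
  proof -
    have X: "compact_space (euclidean :: 'a topology)" using comp by (simp add: compact_space_def)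
    have "locally_compact_space (euclidean :: 'a topology) \<and> regular_space (euclidean :: 'a topology)"
      using compact_imp_locally_compact_space[OF X] compact_Hausdorff_imp_regular_space[OF X] by simp
    then have "euclidean interior_of (\<Union>n. F n) = {}"
      using closedF that by (intro Baire_category_alt) auto
    then show ?thesis by simp
  qed
  ultimately obtain n where "interior (F n) \<noteq> {}" by force
  define e where "e = 1 / real (Suc n)"
  define W where "W = interior (F n)"
  have W: "open W" "W \<noteq> {}" "W \<subseteq> F n"
    using \<open>interior (F n) \<noteq> {}\<close> by (simp_all add: W_def interior_subset)
  have "e > 0" by (simp add: e_def)
  obtain N where N: "\<And>x. \<exists>k\<le>N. (T ^^ k) x \<in> W"
    using minimal_uniform_visits[OF T W(1,2)] by blast
  obtain r where "r > 0"
    and r: "\<And>j a b. j \<le> N \<Longrightarrow> dist a b < r \<Longrightarrow> dist ((T ^^ j) a) ((T ^^ j) b) < e / 2"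
    using funpow_equicontinuous[OF T(1), of "e / 2" N] \<open>e > 0\<close> by auto
  \<comment> \<open>The order of choices matters: \<open>N\<close> and \<open>r\<close> depend only
    on \<open>W\<close> and \<open>e\<close>, and \<open>U\<close> is picked for them.\<close>
  obtain U where U: "open U" "U \<noteq> {}" and Us: "\<And>x y. x \<in> U \<Longrightarrow> proximal T x y \<Longrightarrow> dist x y \<le> r / 2"
    using small[of "r / 2"] \<open>r > 0\<close> by auto
  \<comment> \<open>T need not be open, so a far proximal pair at T^k x is pulled back into U through an open V k.\<close>
  obtain x V where V: "\<And>k. k \<le> N \<Longrightarrow> open (V k) \<and> (T ^^ k) x \<in> V k \<and> (T ^^ k) -` V k \<subseteq> U"
    using minimal_open_preimages_along_orbit[OF T U] by blast
  obtain k where k: "k \<le> N" "(T ^^ k) x \<in> W" using N by blast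
  then have "(T ^^ k) x \<in> F n" using W(3) by blast
  then obtain y where y: "((T ^^ k) x, y) \<in> proximal_closure T" "e \<le> dist ((T ^^ k) x) y"
    unfolding F_def e_def by blast
  \<comment> \<open>Lowering \<open>e\<close> to \<open>e / 2\<close> makes the distance condition
    open, so a true proximal pair approximates the limit pair.\<close>
  define O' where "O' = (V k \<times> UNIV) \<inter> {p. e / 2 < dist (fst p) (snd p)}"
  have "open {p :: 'a \<times> 'a. e / 2 < dist (fst p) (snd p)}"
    by (intro open_Collect_less continuous_intros)
  then have "open O'" unfolding O'_def using V[OF k(1)] by (intro open_Int open_Times) auto
  moreover have "((T ^^ k) x, y) \<in> O'" using V[OF k(1)] y(2) \<open>e > 0\<close> by (simp add: O'_def)
  ultimately obtain a b where ab: "(a, b) \<in> O'" "proximal T a b"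
    using y(1) unfolding proximal_closure_def closure_iff_nhds_not_empty by blast
  have "surj (T ^^ k)" using T(1) by (simp add: tds_def surj_fn)
  then obtain a' b' where a'b': "a = (T ^^ k) a'" "b = (T ^^ k) b'" by (metis surjD)
  have "a' \<in> U" using V[OF k(1)] ab(1) a'b'(1) unfolding O'_def by auto
  moreover have "proximal T a' b'"
    using ab(2) a'b' proximal_funpow_D by blast
  ultimately have "dist a' b' < r" using Us[of a' b'] \<open>r > 0\<close> by auto
  then have "dist a b < e / 2" using r[OF k(1)] a'b' by simp
  with ab(1) show False by (simp add: O'_def)
qed

lemma proximal_of_proximal_closure_chain:
  fixes T :: "'a::metric_space \<Rightarrow> 'a"
  assumes T: "tds T" "minimal_sys T" and x0: "\<And>y. (x0, y) \<in> proximal_closure T \<Longrightarrow> y = x0"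
    and xy: "(x, y) \<in> proximal_closure T" and yz: "(y, z) \<in> proximal_closure T"
  shows "proximal T x z"
  unfolding proximal_iff
proof (intro allI impI)
  fix e :: real assume "e > 0"
  have comp: "compact (UNIV :: 'a set)" using T by (simp add: tds_def)
  have clo: "closed (proximal_closure T)" by (simp add: proximal_closure_def)
  obtain U where U: "open U" "x0 \<in> U" "\<And>a b. a \<in> U \<Longrightarrow> (a, b) \<in> proximal_closure T \<Longrightarrow> dist a b < e / 2"
    using fibres_small_near_singleton_fibre[OF comp clo x0, of "e / 2"] \<open>e > 0\<close> by auto
  obtain r where r: "r > 0" "ball x0 r \<subseteq> U" using U by (meson openE)
  \<comment> \<open>This second, finer scale brings \<open>T^k y\<close> as well as
    \<open>T^k x\<close> into \<open>U\<close>, where the next link of the chain is short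
    too.\<close>
  obtain U' where U': "open U'" "x0 \<in> U'" "\<And>a b. a \<in> U' \<Longrightarrow> (a, b) \<in> proximal_closure T \<Longrightarrow> dist a b < r / 2"
    using fibres_small_near_singleton_fibre[OF comp clo x0, of "r / 2"] r by auto
  have "x0 \<in> U' \<inter> ball x0 (r / 2)" "open (U' \<inter> ball x0 (r / 2))"
    using U'(1,2) r(1) by auto
  then obtain k where k: "(T ^^ k) x \<in> U' \<inter> ball x0 (r / 2)"
    by (metis minimal_orbit_meets_open[OF T(2)] empty_iff)
  have "dist ((T ^^ k) x) ((T ^^ k) y) < r / 2"
    using U'(3) k proximal_closure_funpow[OF T(1) xy] by blast
  moreover have "dist x0 ((T ^^ k) x) < r / 2" using k by simp
  ultimately have "dist x0 ((T ^^ k) x) < r" "dist x0 ((T ^^ k) y) < r"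
    using r(1) dist_triangle[of x0 "(T ^^ k) y" "(T ^^ k) x"] by linarith+
  then have "(T ^^ k) x \<in> U" "(T ^^ k) y \<in> U"
    using r(2) by auto
  then have "dist ((T ^^ k) x) ((T ^^ k) y) < e / 2" "dist ((T ^^ k) y) ((T ^^ k) z) < e / 2"
    using U(3) proximal_closure_funpow[OF T(1)] xy yz by blast+
  then show "\<exists>n. dist ((T ^^ n) x) ((T ^^ n) z) < e"
    using dist_triangle_half_r[of "(T ^^ k) y" "(T ^^ k) x" e "(T ^^ k) z"] by (auto simp: dist_commute)
qed

text \<open>Chains with one trivial link show that the proximal relation is closed, and chains of
  proximal pairs show that it is transitive. It is therefore one of the relations being intersected,
  and the smallest.\<close>

lemma max_distal_rel_eq_proximal:
  fixes T :: "'a::metric_space \<Rightarrow> 'a"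
  assumes T: "tds T" "minimal_sys T" and x0: "\<And>y. (x0, y) \<in> proximal_closure T \<Longrightarrow> y = x0"
  shows "max_distal_rel T = {(x, y). proximal T x y}"
proof
  let ?P = "{(x, y). proximal T x y}"
  have sub: "?P \<subseteq> proximal_closure T" by (simp add: proximal_closure_def closure_subset)
  note chain = proximal_of_proximal_closure_chain[OF T x0]
  have "proximal_closure T \<subseteq> ?P"
    using chain[of _ _ _] sub proximal_refl by fastforce
  then have "closed ?P" using sub unfolding proximal_closure_def by (metis closed_closure subset_antisym)
  moreover have "equiv UNIV ?P"
  proof (rule equivI)
    show "refl ?P" by (simp add: refl_on_def proximal_refl)
    show "sym ?P" by (auto intro!: symI proximal_sym)
    show "trans ?P" using sub chain unfolding trans_def by blast
  qed simp
  moreover have "\<forall>(x, y)\<in>?P. (T x, T y) \<in> ?P"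
    using proximal_funpow[OF T(1), of _ _ 1] by auto
  ultimately show "max_distal_rel T \<subseteq> ?P" unfolding max_distal_rel_def by blast
  show "?P \<subseteq> max_distal_rel T" unfolding max_distal_rel_def by blast
qed

section \<open>Fibres over the maximal distal factor\<close>

lemma proximal_imp_not_almost_one_to_one:
  fixes T :: "'a::metric_space \<Rightarrow> 'a"
  assumes comp: "compact (UNIV :: 'a set)" and fac: "max_distal_factor T S \<pi>" and "\<delta> > 0"
    and prox: "\<And>U. open U \<Longrightarrow> U \<noteq> {} \<Longrightarrow> \<exists>x\<in>U. \<exists>y. proximal T x y \<and> dist x y > \<delta>"
  shows "\<not> almost_one_to_one \<pi>"
proof
  assume "almost_one_to_one \<pi>"
  then have "{x. \<pi> -` {\<pi> x} = {x}} \<noteq> {}"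
    unfolding almost_one_to_one_def by (metis UNIV_not_empty closure_empty)
  then obtain x0 where x0: "\<pi> -` {\<pi> x0} = {x0}" by blast
  have rel: "{(x, y). \<pi> x = \<pi> y} = max_distal_rel T" using fac by (simp add: max_distal_factor_def)
  have clo: "closed (max_distal_rel T)" unfolding max_distal_rel_def by (intro closed_Inter) blast
  have "y = x0" if "(x0, y) \<in> max_distal_rel T" for y
    using that x0 unfolding rel[symmetric] by auto
  then obtain U where U: "open U" "x0 \<in> U" "\<And>x y. x \<in> U \<Longrightarrow> (x, y) \<in> max_distal_rel T \<Longrightarrow> dist x y < \<delta>"
    using fibres_small_near_singleton_fibre[OF comp clo _ \<open>\<delta> > 0\<close>] by metis
  then obtain x y where "x \<in> U" "proximal T x y" "dist x y > \<delta>" using prox[of U] by blast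
  moreover have "{(x, y). proximal T x y} \<subseteq> max_distal_rel T" unfolding max_distal_rel_def by blast
  ultimately show False using U(3)[of x y] by auto
qed

lemma not_almost_one_to_one_imp_proximal:
  fixes T :: "'a::metric_space \<Rightarrow> 'a"
  assumes T: "tds T" "minimal_sys T" and fac: "max_distal_factor T S \<pi>" and "\<not> almost_one_to_one \<pi>"
  shows "\<exists>\<delta>>0. \<forall>U. open U \<and> U \<noteq> {} \<longrightarrow> (\<exists>x\<in>U. \<exists>y. proximal T x y \<and> dist x y > \<delta>)"
proof (rule ccontr)
  assume no: "\<not> ?thesis"
  have "\<exists>U. open U \<and> U \<noteq> {} \<and> (\<forall>x\<in>U. \<forall>y. proximal T x y \<longrightarrow> dist x y \<le> \<delta>)" if "\<delta> > 0" for \<delta>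
    using no that by (meson not_le)
  then obtain x0 where x0: "\<And>y. (x0, y) \<in> proximal_closure T \<Longrightarrow> y = x0"
    using ex_singleton_proximal_closure_fibre[OF T] by blast
  have rel: "\<pi> x = \<pi> y \<longleftrightarrow> proximal T x y" for x y
    using max_distal_rel_eq_proximal[OF T x0] fac unfolding max_distal_factor_def by blast
  have "{(x, y). proximal T x y} \<subseteq> proximal_closure T"
    by (simp add: proximal_closure_def closure_subset)
  then have x0': "proximal T x0 y \<Longrightarrow> y = x0" for y
    using x0[of y] by blast
  have "\<pi> -` {\<pi> ((T ^^ k) x0)} = {(T ^^ k) x0}" for k
  proof -
    have "y = (T ^^ k) x0" if "proximal T y ((T ^^ k) x0)" for y
    proof -
      \<comment> \<open>Proximality pulls back along iterates, so a partner of \<open>T^k x0\<close>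
        is the image of a partner of \<open>x0\<close>, that is, of \<open>x0\<close>
        itself.\<close>
      have "surj (T ^^ k)" using T(1) by (simp add: tds_def surj_fn)
      then obtain z where z: "y = (T ^^ k) z" by (metis surjD)
      with that have "proximal T x0 z" using proximal_funpow_D proximal_sym by blast
      then show ?thesis using z x0' by blast
    qed
    then show ?thesis using rel proximal_refl by auto
  qed
  then have "closure (range (\<lambda>k. (T ^^ k) x0)) \<subseteq> closure {x. \<pi> -` {\<pi> x} = {x}}"
    by (intro closure_mono) auto
  then have "almost_one_to_one \<pi>"
    using T(2) unfolding minimal_sys_def almost_one_to_one_def by blast
  with assms(4) show False by simp
qed

theorem theorem4p12:
  fixes T :: "'a::metric_space \<Rightarrow> 'a" and S :: "'b::metric_space \<Rightarrow> 'b" and \<pi> :: "'a \<Rightarrow> 'b"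
  assumes "tds T" and "minimal_sys T" and "max_distal_factor T S \<pi>"
  shows "(strongly_F_sensitive F_ip T
           \<longleftrightarrow> (\<exists>\<delta>>0. \<forall>U. open U \<and> U \<noteq> {} \<longrightarrow>
                  (\<exists>x\<in>U. \<exists>y. proximal T x y \<and> dist x y > \<delta>)))
       \<and> (strongly_F_sensitive F_ip T \<longleftrightarrow> \<not> almost_one_to_one \<pi>)"
  (is "(?IP \<longleftrightarrow> ?prox) \<and> (?IP \<longleftrightarrow> ?na)")
proof -
  have "?IP \<Longrightarrow> ?prox"
    by (rule strongly_IP_sensitive_imp_proximal[OF assms(1)])
  moreover have "?prox \<Longrightarrow> ?IP"
    using proximal_imp_strongly_IP_sensitive[OF assms(1,2)] by blast
  moreover have "compact (UNIV :: 'a set)" using assms(1) by (simp add: tds_def)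
  then have "?prox \<Longrightarrow> ?na"
    using proximal_imp_not_almost_one_to_one[OF _ assms(3)] by blast
  moreover have "?na \<Longrightarrow> ?prox"
    by (rule not_almost_one_to_one_imp_proximal[OF assms])
  ultimately show ?thesis by blast
qed

end
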